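(* The randomized query complexity of learning a hidden matrix from $\mathcal{M}_n$ with edge queries is $\Theta(n^2)$. That is, the minimum worst-case number of edge queries of a randomized algorithm that outputs the hidden matrix with probability at least $2/3$ on every input from $\mathcal{M}_n$ is $\Theta(n^2)$.
   Context: $\mathcal{M}_n$ is the set of all $n\times n$ permutation matrices (bipartite adjacency matrices of perfect matchings between two copies of $[n]$). An edge query on $(i,j)\in[n]\times[n]$ returns the entry $(i,j)$ of the hidden matrix. A randomized algorithm is a probability distribution over deterministic decision trees, and its cost is the maximum depth of a tree in its support. *)

theory Defs
  imports
    "HOL-Probability.Probability_Mass_Function"
    "HOL-Library.Landau_Symbols"
    "HOL-Library.Extended_Nat"
    "HOL-Combinatorics.Permutations"
    "Jordan_Normal_Form.Matrix"
begin

text \<open>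
  The index set \<open>[n]\<close> is \<open>{0..<n}\<close>, as is usual for the type \<open>'a mat\<close>. With entries in \<open>nat\<close>,
  there are only countably many matrices, hence only countably many decision trees below, so that
  \<open>decision_tree pmf\<close> contains all probability distributions over decision trees.
\<close>

definition perm_matrix :: "nat \<Rightarrow> (nat \<Rightarrow> nat) \<Rightarrow> nat mat" where
  "perm_matrix n p = Matrix.mat n n (\<lambda>(i, j). if p i = j then 1 else 0)"

definition perm_matrices :: "nat \<Rightarrow> nat mat set" where
  "perm_matrices n = {perm_matrix n p | p. p permutes {0..<n}}"

text \<open>
  \<open>Query i j t\<^sub>0 t\<^sub>1\<close> asks for entry \<open>(i, j)\<close> and continues with \<open>t\<^sub>0\<close> or \<open>t\<^sub>1\<close> according to the answer.
\<close>

datatype decision_tree =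
    Output "nat mat"
  | Query nat nat decision_tree decision_tree

primrec run :: "decision_tree \<Rightarrow> nat mat \<Rightarrow> nat mat" where
  "run (Output B) A = B"
| "run (Query i j t0 t1) A = (if A $$ (i, j) = 1 then run t1 A else run t0 A)"

primrec depth :: "decision_tree \<Rightarrow> nat" where
  "depth (Output B) = 0"
| "depth (Query i j t0 t1) = Suc (max (depth t0) (depth t1))"

primrec queries_within :: "nat \<Rightarrow> decision_tree \<Rightarrow> bool" where
  "queries_within n (Output B) \<longleftrightarrow> True"
| "queries_within n (Query i j t0 t1) \<longleftrightarrow>
     i < n \<and> j < n \<and> queries_within n t0 \<and> queries_within n t1"

definition randomized_algorithm :: "nat \<Rightarrow> decision_tree pmf \<Rightarrow> bool" where
  "randomized_algorithm n R \<longleftrightarrow> (\<forall>t\<in>set_pmf R. queries_within n t)"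

definition learns_perm_matrices :: "nat \<Rightarrow> decision_tree pmf \<Rightarrow> bool" where
  "learns_perm_matrices n R \<longleftrightarrow>
     (\<forall>A\<in>perm_matrices n. measure_pmf.prob R {t. run t A = A} \<ge> 2 / 3)"

text \<open>
  The supremum is taken in \<open>enat\<close>, so that a distribution over trees of unbounded depth has
  infinite cost; a finite supremum is a maximum.
\<close>

definition cost :: "decision_tree pmf \<Rightarrow> enat" where
  "cost R = (SUP t\<in>set_pmf R. enat (depth t))"

definition randomized_query_complexity :: "nat \<Rightarrow> nat" where
  "randomized_query_complexity n =
     (LEAST q. \<exists>R. randomized_algorithm n R \<and> learns_perm_matrices n R \<and> cost R = enat q)"

end

theory Submission
  imports Defs
begin

text \<open>
  The lower bound is a counting argument. A tree outputs at most one matrix per leaf, so it is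
  correct on at most as many permutation matrices as it has leaves reached with at most \<open>n\<close>
  positive answers. Giving every positive answer the weight \<open>1/y\<close> bounds this number by
  \<open>(1 + 1/y)^q * y^n\<close> for depth \<open>q\<close>. With \<open>y = n/16\<close> and \<open>q \<le> n\<^sup>2/16\<close> this is at most
  \<open>exp n * (n/16)^n \<le> (exp 2 / 16)^n * n!\<close>, whereas averaging the success probability over all
  inputs shows that some tree in the support is correct on at least \<open>2/3 * n!\<close> of them.
\<close>

section \<open>Permutation matrices and their positive entries\<close>

text \<open>The positions where a query is answered positively; their number limits how many
  distinct positive answers an input can give.\<close>

definition ones :: "nat \<Rightarrow> nat mat \<Rightarrow> (nat \<times> nat) set" where
  "ones n A = {(i, j). i < n \<and> j < n \<and> A $$ (i, j) = 1}"

lemma finite_ones: "finite (ones n A)"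
  by (rule finite_subset[of _ "{0..<n} \<times> {0..<n}"]) (auto simp: ones_def)

lemma card_ones_perm_matrix:
  assumes "p permutes {0..<n}"
  shows "card (ones n (perm_matrix n p)) = n"
proof -
  have "ones n (perm_matrix n p) = (\<lambda>i. (i, p i)) ` {0..<n}"
  proof (intro Set.set_eqI iffI)
    fix c assume "c \<in> ones n (perm_matrix n p)"
    then show "c \<in> (\<lambda>i. (i, p i)) ` {0..<n}"
      by (cases c) (auto simp: ones_def perm_matrix_def image_iff split: if_split_asm)
  next
    fix c assume "c \<in> (\<lambda>i. (i, p i)) ` {0..<n}"
    then obtain i where i: "i < n" "c = (i, p i)"
      by auto
    moreover have "p i < n"
      using permutes_in_image[OF assms, of i] i(1) by simp
    ultimately show "c \<in> ones n (perm_matrix n p)"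
      by (simp add: ones_def perm_matrix_def)
  qed
  moreover have "inj_on (\<lambda>i. (i, p i)) {0..<n}"
    by (auto intro: inj_onI)
  ultimately show ?thesis
    by (simp add: card_image)
qed

lemma inj_on_perm_matrix: "inj_on (perm_matrix n) {p. p permutes {0..<n}}"
proof (rule inj_onI, clarify)
  fix p q assume p: "p permutes {0..<n}" and q: "q permutes {0..<n}"
    and eq: "perm_matrix n p = perm_matrix n q"
  show "p = q"
  proof
    fix i
    show "p i = q i"
    proof (cases "i < n")
      case True
      then have "p i < n"
        using permutes_in_image[OF p, of i] by simp
      moreover have "perm_matrix n p $$ (i, p i) = perm_matrix n q $$ (i, p i)"
        using eq by simp
      ultimately show ?thesis
        using True by (simp add: perm_matrix_def split: if_splits)
    next
      case False
      then show ?thesis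
        using p q by (simp add: permutes_def)
    qed
  qed
qed

lemma perm_matrices_eq_image: "perm_matrices n = perm_matrix n ` {p. p permutes {0..<n}}"
  by (auto simp: perm_matrices_def)

lemma finite_perm_matrices: "finite (perm_matrices n)"
  by (simp add: perm_matrices_eq_image finite_permutations)

lemma card_perm_matrices: "card (perm_matrices n) = fact n"
  by (simp add: perm_matrices_eq_image card_image[OF inj_on_perm_matrix] card_permutations)

section \<open>Weighted count of the inputs on which one tree is correct\<close>

text \<open>
  \<open>F\<close> collects the positive answers received so far; keeping it as a set makes repeated queries
  harmless.
\<close>

lemma card_correct_le_aux:
  fixes y :: real
  assumes y: "y \<ge> 1" and "finite X" "finite F" "queries_within n t"
    and "\<And>A. A \<in> X \<Longrightarrow> card (ones n A) \<le> m" "\<And>A. A \<in> X \<Longrightarrow> F \<subseteq> ones n A"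
  shows "real (card {A \<in> X. run t A = A}) \<le> (1 + 1 / y) ^ depth t * y ^ (m - card F)"
  using assms(2-)
proof (induction t arbitrary: X F)
  case (Output B)
  have "card {A \<in> X. run (Output B) A = A} \<le> card {B}"
    by (intro card_mono) auto
  moreover have "1 \<le> y ^ (m - card F)"
    using y by simp
  ultimately show ?case
    by simp
next
  case (Query i j t0 t1)
  define d where "d = max (depth t0) (depth t1)"
  define X0 where "X0 = {A \<in> X. (i, j) \<notin> ones n A}"
  define X1 where "X1 = {A \<in> X. (i, j) \<in> ones n A}"
  have ij: "A $$ (i, j) = 1 \<longleftrightarrow> (i, j) \<in> ones n A" for A
    using Query.prems(3) by (simp add: ones_def)
  have "{A \<in> X. run (Query i j t0 t1) A = A} =
      {A \<in> X0. run t0 A = A} \<union> {A \<in> X1. run t1 A = A}"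
    unfolding run.simps ij X0_def X1_def by (auto split: if_splits)
  then have split: "card {A \<in> X. run (Query i j t0 t1) A = A} \<le>
      card {A \<in> X0. run t0 A = A} + card {A \<in> X1. run t1 A = A}"
    by (simp add: card_Un_le)
  \<comment> \<open>The factor \<open>1 + 1 / y\<close> is at least 1, so the shallower subtree may
    be counted as if it had depth \<open>d\<close>.\<close>
  have pow: "(1 + 1 / y) ^ e * y ^ k \<le> (1 + 1 / y) ^ d * y ^ k" if "e \<le> d" for e k
    using that y by (intro mult_right_mono power_increasing) auto
  have 0: "real (card {A \<in> X0. run t0 A = A}) \<le> (1 + 1 / y) ^ d * y ^ (m - card F)"
    by (rule order_trans[OF Query.IH(1) pow])
       (use Query.prems in \<open>auto simp: X0_def d_def\<close>)
  \<comment> \<open>A negative answer keeps the weight and a new positive one divides it by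
    \<open>y\<close>; together they yield one more factor \<open>1 + 1 / y\<close>.\<close>
  have grow: "(1 + 1 / y) ^ d * y ^ k + (1 + 1 / y) ^ d * (y ^ k / y) =
      (1 + 1 / y) ^ Suc d * y ^ k" for k
    by (simp add: algebra_simps)
  show ?case
  proof (cases "(i, j) \<in> F")
    case True
    \<comment> \<open>A repeated query with a known positive answer leaves one live branch, so the
      weight need not drop and the extra depth is slack.\<close>
    then have "X0 = {}"
      using Query.prems(5) by (auto simp: X0_def)
    have 1: "real (card {A \<in> X1. run t1 A = A}) \<le> (1 + 1 / y) ^ d * y ^ (m - card F)"
      by (rule order_trans[OF Query.IH(2) pow])
         (use Query.prems in \<open>auto simp: X1_def d_def\<close>)
    have "(1 + 1 / y) ^ d * y ^ (m - card F) \<le> (1 + 1 / y) ^ Suc d * y ^ (m - card F)"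
      using y by (intro mult_right_mono power_increasing) auto
    then show ?thesis
      using 1 split \<open>X0 = {}\<close> by (simp add: d_def)
  next
    case False
    have 1: "real (card {A \<in> X1. run t1 A = A}) \<le> (1 + 1 / y) ^ d * (y ^ (m - card F) / y)"
    \<comment> \<open>Subtraction truncates at 0, so division by \<open>y\<close> lowers the
      exponent only if \<open>card F < m\<close>. Any member of \<open>X1\<close> guarantees this:
      its ones include \<open>F\<close> and the new position.\<close>
    proof (cases "X1 = {}")
      case True
      then show ?thesis
        using y by simp
    next
      case nonempty: False
      then obtain A where A: "A \<in> X" "(i, j) \<in> ones n A"
        by (auto simp: X1_def)
      then have "card (insert (i, j) F) \<le> card (ones n A)"
        using Query.prems(5) by (intro card_mono finite_ones) auto
      then have "Suc (card F) \<le> m"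
        using Query.prems(2,4) A False by fastforce
      then have "m - card F = Suc (m - card (insert (i, j) F))"
        using Query.prems(2) False by simp
      then have exponent: "y ^ (m - card F) / y = y ^ (m - card (insert (i, j) F))"
        using y by simp
      show ?thesis
        unfolding exponent
        by (rule order_trans[OF Query.IH(2) pow])
           (use Query.prems in \<open>auto simp: X1_def d_def\<close>)
    qed
    show ?thesis
      using 0 1 split grow[of "m - card F"] by (simp add: d_def)
  qed
qed

text \<open>Each permutation matrix has exactly \<open>n\<close> ones, so the weighted count applies
  with \<open>m = n\<close> and \<open>F\<close> empty.\<close>

lemma card_correct_le:
  fixes y :: real
  assumes "y \<ge> 1" "queries_within n t"
  shows "real (card {A \<in> perm_matrices n. run t A = A}) \<le> (1 + 1 / y) ^ depth t * y ^ n"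
proof -
  have "card (ones n A) \<le> n" if "A \<in> perm_matrices n" for A
    using that by (auto simp: perm_matrices_eq_image card_ones_perm_matrix)
  then show ?thesis
    using card_correct_le_aux[OF assms(1) finite_perm_matrices finite.emptyI assms(2)] by simp
qed

section \<open>Averaging over inputs and the lower bound\<close>

text \<open>Exchanging sum and expectation turns the left side into the expected number of inputs on
  which a random tree is correct.\<close>

lemma sum_prob_correct_le:
  assumes "finite X" and "\<And>t. t \<in> set_pmf R \<Longrightarrow> real (card {A \<in> X. run t A = A}) \<le> c"
  shows "(\<Sum>A\<in>X. measure_pmf.prob R {t. run t A = A}) \<le> c"
proof -
  have int: "integrable R (\<lambda>t. indicator {t. run t A = A} t :: real)" for A
    by (intro measure_pmf.integrable_const_bound[where B = 1]) auto
  have "(\<Sum>A\<in>X. measure_pmf.prob R {t. run t A = A}) =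
      (\<integral>t. (\<Sum>A\<in>X. indicator {t. run t A = A} t) \<partial>measure_pmf R)"
    using int by (subst Bochner_Integration.integral_sum) auto
  also have "\<dots> \<le> (\<integral>t. c \<partial>measure_pmf R)"
  proof (intro integral_mono_AE)
    show "integrable R (\<lambda>t. \<Sum>A\<in>X. indicator {t. run t A = A} t :: real)"
      using int by (intro Bochner_Integration.integrable_sum)
    show "AE t in R. (\<Sum>A\<in>X. indicator {t. run t A = A} t) \<le> c"
    proof (rule AE_pmfI)
      fix t assume "t \<in> set_pmf R"
      have "(\<Sum>A\<in>X. indicator {t. run t A = A} t) = real (card {A \<in> X. run t A = A})"
        using assms(1) by (simp add: indicator_def sum.If_cases Int_def)
      then show "(\<Sum>A\<in>X. indicator {t. run t A = A} t) \<le> c"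
        using assms(2)[OF \<open>t \<in> set_pmf R\<close>] by simp
    qed
  qed simp
  finally show ?thesis
    by simp
qed

text \<open>The term of index \<open>n\<close> in the exponential series at \<open>n\<close> is at
  most the whole sum, since all terms are nonnegative.\<close>

lemma power_self_le_exp_fact: "real n ^ n \<le> exp (real n) * fact n"
proof -
  have "(\<Sum>k\<in>{n}. real n ^ k /\<^sub>R fact k) \<le> (\<Sum>k. real n ^ k /\<^sub>R fact k)"
    by (intro sum_le_suminf summable_exp_generic) auto
  then have "real n ^ n / fact n \<le> exp (real n)"
    by (simp add: exp_def field_simps)
  then show ?thesis
    by (simp add: field_simps)
qed

lemma cost_lower_bound:
  assumes n: "n \<ge> 16" and R: "randomized_algorithm n R" "learns_perm_matrices n R"
    and cost: "cost R = enat q"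
  shows "real n ^ 2 / 16 \<le> real q"
proof (rule ccontr)
  assume "\<not> real n ^ 2 / 16 \<le> real q"
  then have q: "real q * (16 / real n) \<le> real n"
    using n by (simp add: field_simps power2_eq_square)
  \<comment> \<open>This \<open>y\<close> turns \<open>exp (1 / y) ^ q\<close> into the exponential
    bounded through \<open>q\<close>, while \<open>y ^ n\<close> gains the divisor
    \<open>16 ^ n\<close>. The counting bound needs \<open>y \<ge> 1\<close>, hence
    \<open>n \<ge> 16\<close>.\<close>
  define y where "y = real n / 16"
  have y: "y \<ge> 1"
    using n by (simp add: y_def)
  have "2 / 3 * fact n = (\<Sum>A\<in>perm_matrices n. 2 / 3 :: real)"
    by (simp add: card_perm_matrices)
  also have "\<dots> \<le> (\<Sum>A\<in>perm_matrices n. measure_pmf.prob R {t. run t A = A})"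
    using R(2) by (intro sum_mono) (simp add: learns_perm_matrices_def)
  also have "\<dots> \<le> (1 + 1 / y) ^ q * y ^ n"
  proof (rule sum_prob_correct_le[OF finite_perm_matrices])
    fix t assume t: "t \<in> set_pmf R"
    have "enat (depth t) \<le> cost R"
      unfolding cost_def using t by (rule SUP_upper)
    then have "(1 + 1 / y) ^ depth t * y ^ n \<le> (1 + 1 / y) ^ q * y ^ n"
      using y cost by (intro mult_right_mono power_increasing) auto
    moreover have "queries_within n t"
      using R(1) t by (simp add: randomized_algorithm_def)
    ultimately show "real (card {A \<in> perm_matrices n. run t A = A}) \<le> (1 + 1 / y) ^ q * y ^ n"
      using card_correct_le[OF y] by (meson order_trans)
  qed
  also have "(1 + 1 / y) ^ q \<le> exp (1 / y) ^ q"
    using y by (intro power_mono exp_ge_add_one_self) auto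
  also have "exp (1 / y) ^ q = exp (real q * (16 / real n))"
    by (simp only: y_def exp_of_nat_mult divide_divide_eq_right mult_1)
  also have "\<dots> \<le> exp (real n)"
    using q by simp
  also have "exp (real n) * y ^ n = exp (real n) * real n ^ n / 16 ^ n"
    by (simp add: y_def power_divide)
  also have "\<dots> \<le> exp (real n) * (exp (real n) * fact n) / 16 ^ n"
    by (intro divide_right_mono mult_left_mono power_self_le_exp_fact) auto
  also have "\<dots> = (exp 1 * exp 1 / 16) ^ n * fact n"
    by (simp add: power_divide power_mult_distrib exp_of_nat_mult[symmetric])
  \<comment> \<open>From \<open>exp 1 \<le> 3\<close> the base is at most \<open>9 / 16\<close>,
    already below \<open>2 / 3\<close>, so a single factor suffices for the contradiction.\<close>
  also have "\<dots> \<le> (9 / 16) ^ n * fact n"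
    using mult_mono[OF exp_le exp_le] by (intro mult_right_mono power_mono) auto
  also have "\<dots> \<le> (9 / 16) ^ 1 * fact n"
    using n by (intro mult_right_mono power_decreasing) auto
  finally have "2 / 3 * fact n \<le> 9 / 16 * (fact n :: real)"
    using y by simp
  then show False
    by simp
qed

section \<open>Upper bound by querying every entry\<close>

text \<open>Started from the empty set, \<open>S\<close> accumulates the positions answered
  positively, so each leaf knows the ones found on its path.\<close>

primrec exhaustive_tree :: "nat \<Rightarrow> (nat \<times> nat) list \<Rightarrow> (nat \<times> nat) set \<Rightarrow> decision_tree" where
  "exhaustive_tree n [] S = Output (Matrix.mat n n (\<lambda>c. if c \<in> S then 1 else 0))"
| "exhaustive_tree n (c # cs) S =
     Query (fst c) (snd c) (exhaustive_tree n cs S) (exhaustive_tree n cs (insert c S))"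

lemma depth_exhaustive_tree: "depth (exhaustive_tree n cs S) = length cs"
  by (induction cs arbitrary: S) auto

lemma queries_within_exhaustive_tree:
  "set cs \<subseteq> {0..<n} \<times> {0..<n} \<Longrightarrow> queries_within n (exhaustive_tree n cs S)"
  by (induction cs arbitrary: S) auto

lemma run_exhaustive_tree:
  "run (exhaustive_tree n cs S) A =
     Matrix.mat n n (\<lambda>c. if c \<in> S \<or> c \<in> set cs \<and> A $$ c = 1 then 1 else 0)"
proof (induction cs arbitrary: S)
  case (Cons c cs)
  then show ?case
    by (cases c) (auto intro!: cong_mat)
qed simp

text \<open>A point mass on the exhaustive tree works. Besides the upper bound, this shows that the
  minimum in the definition of the complexity is attained.\<close>

lemma exists_algorithm:
  "\<exists>R. randomized_algorithm n R \<and> learns_perm_matrices n R \<and> cost R = enat (n ^ 2)"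
proof (intro exI conjI)
  define t where "t = exhaustive_tree n (List.product [0..<n] [0..<n]) {}"
  show "randomized_algorithm n (return_pmf t)"
    by (auto simp: randomized_algorithm_def t_def intro!: queries_within_exhaustive_tree)
  \<comment> \<open>Entries of a permutation matrix are 0 or 1, so the positions of its ones
    determine it.\<close>
  have "run t A = A" if "A \<in> perm_matrices n" for A
    using that
    by (auto simp: t_def run_exhaustive_tree perm_matrices_eq_image perm_matrix_def
        intro!: eq_matI)
  then show "learns_perm_matrices n (return_pmf t)"
    by (simp add: learns_perm_matrices_def)
  show "cost (return_pmf t) = enat (n ^ 2)"
    by (simp add: cost_def t_def depth_exhaustive_tree power2_eq_square)
qed

lemma randomized_query_complexity_le: "randomized_query_complexity n \<le> n ^ 2"
  unfolding randomized_query_complexity_def by (intro Least_le exists_algorithm)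

lemma randomized_query_complexity_ge:
  assumes "n \<ge> 16"
  shows "real n ^ 2 / 16 \<le> real (randomized_query_complexity n)"
proof -
  have "\<exists>R. randomized_algorithm n R \<and> learns_perm_matrices n R \<and>
      cost R = enat (randomized_query_complexity n)"
    unfolding randomized_query_complexity_def by (rule LeastI) (rule exists_algorithm)
  then show ?thesis
    using cost_lower_bound[OF assms] by blast
qed

theorem theorem3p4:
  shows "(\<lambda>n. real (randomized_query_complexity n)) \<in> \<Theta>(\<lambda>n. real n ^ 2)"
proof (rule bigthetaI)
  show "(\<lambda>n. real (randomized_query_complexity n)) \<in> O(\<lambda>n. real n ^ 2)"
    using randomized_query_complexity_le
    by (intro bigoI[where c = 1] always_eventually allI)
       (simp flip: of_nat_power)
  show "(\<lambda>n. real (randomized_query_complexity n)) \<in> \<Omega>(\<lambda>n. real n ^ 2)"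
  proof (rule landau_omega.bigI[where c = "1 / 16"])
    show "\<forall>\<^sub>F n in sequentially.
        norm (real (randomized_query_complexity n)) \<ge> 1 / 16 * norm (real n ^ 2)"
      using eventually_ge_at_top[of 16]
      by eventually_elim (use randomized_query_complexity_ge in simp)
  qed simp
qed

end
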